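(* Let $\mathcal C(\theta)=(x(\theta),y(\theta),z(\theta))$, $\theta\in\mathbb{R}$, be a smooth parametrized curve in $H_1$ and define $$Y(r,\theta)=\big(x(\theta)+r\cos\theta,\ y(\theta)+r\sin\theta,\ z(\theta)+r\,y(\theta)\cos\theta-r\,x(\theta)\sin\theta\big),\qquad r\in\mathbb{R}.$$ If $\mathcal C$ satisfies $$z'(\theta)+x(\theta)y'(\theta)-y(\theta)x'(\theta)-\big(y'(\theta)\cos\theta-x'(\theta)\sin\theta\big)^2=0\quad\text{for all }\theta,$$ or equivalently $z(\theta)=\int\big[(y'\cos\theta-x'\sin\theta)^2+y\,x'-x\,y'\big]d\theta$, then $Y$ defines a $p$-minimal surface of special type I, and its $\zeta_1$-invariant is $$\zeta_1(\theta)=y'(\theta)\cos\theta-x'(\theta)\sin\theta-\int\big[x'(\theta)\cos\theta+y'(\theta)\sin\theta\big]d\theta,$$ where the last integral is an anti-derivative of $x'(\theta)\cos\theta+y'(\theta)\sin\theta$.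
   Context: The Heisenberg group $H_1$ is $\mathbb{R}^3$ with the group law $(x_1,y_1,z_1)\circ(x_2,y_2,z_2)=(x_1+x_2,\,y_1+y_2,\,z_1+z_2+y_1x_2-x_1y_2)$. Left invariant fields: $\mathring e_1=\partial_x+y\partial_z$, $\mathring e_2=\partial_y-x\partial_z$, $T=\partial_z$. Contact form $\Theta=dz+x\,dy-y\,dx$, contact bundle $\xi=\ker\Theta$, $J\mathring e_1=\mathring e_2$, $J\mathring e_2=-\mathring e_1$. The adapted metric makes $\mathring e_1,\mathring e_2,T$ orthonormal; $\nabla$ is the connection for which they are parallel. All objects are $C^\infty$. For a surface in $H_1$, a point is singular if its tangent plane equals $\xi_p$, otherwise regular. On the regular part choose a unit tangent field $e_1\in\xi$ (up to sign; for $Y$ one takes $e_1=Y_r$), $e_2=Je_1$; $H$ is defined by $\nabla_{e_1}e_2=-He_1$; $p$-minimal means $H=0$. The $\alpha$-function is defined by requiring $\alpha e_2+T$ to be tangent; $\hat e_2=\frac{\alpha e_2+T}{\sqrt{1+\alpha^2}}$. The surface is of special type I with $\zeta_1$-invariant $\zeta_1$ if there are coordinates $(\tilde x,\tilde y)$ (normal coordinates) with $e_1=\partial_{\tilde x}$, $\hat e_2=b\,\partial_{\tilde y}$, $\alpha=\frac1{\tilde x+\zeta_1(\tilde y)}$, $b=\frac{\alpha^2}{\sqrt{1+\alpha^2}}$; $\zeta_1$ is determined up to translation of $\tilde y$ and addition of a constant. The assertion concerns the points $(r,\theta)$ at which $Y$ is an immersion with regular image point, and here $\tilde y=\theta$.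 *)

theory Defs
  imports "HOL-Analysis.Analysis"
begin

section \<open>Smooth maps\<close>

text \<open>Only used on open sets. In finite dimension, continuity of all directional derivatives
  up to order \<open>k\<close> is the usual \<open>C^k\<close> condition.\<close>

primrec Ck_on :: "nat \<Rightarrow> 'a::real_normed_vector set \<Rightarrow> ('a \<Rightarrow> 'b::real_normed_vector) \<Rightarrow> bool" where
  "Ck_on 0 S f \<longleftrightarrow> continuous_on S f"
| "Ck_on (Suc k) S f \<longleftrightarrow>
     (\<forall>x\<in>S. f differentiable (at x)) \<and> (\<forall>v. Ck_on k S (\<lambda>x. frechet_derivative f (at x) v))"

definition smooth_on :: "'a::real_normed_vector set \<Rightarrow> ('a \<Rightarrow> 'b::real_normed_vector) \<Rightarrow> bool" where
  "smooth_on S f \<longleftrightarrow> (\<forall>k. Ck_on k S f)"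

definition antiderivative :: "(real \<Rightarrow> real) \<Rightarrow> (real \<Rightarrow> real) \<Rightarrow> bool" where
  "antiderivative F f \<longleftrightarrow> (\<forall>t. (F has_real_derivative f t) (at t))"

section \<open>The Heisenberg group\<close>

text \<open>Tangent vectors at a point are given by their components with respect to
  \<open>\<partial>\<^sub>x, \<partial>\<^sub>y, \<partial>\<^sub>z\<close>, so they have the same type as points.\<close>

type_synonym heis = "real \<times> real \<times> real"

fun heis_mult :: "heis \<Rightarrow> heis \<Rightarrow> heis" where
  "heis_mult (x1, y1, z1) (x2, y2, z2) = (x1 + x2, y1 + y2, z1 + z2 + y1 * x2 - x1 * y2)"

fun E1 :: "heis \<Rightarrow> heis" where "E1 (x, y, z) = (1, 0, y)"
fun E2 :: "heis \<Rightarrow> heis" where "E2 (x, y, z) = (0, 1, - x)"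
fun T :: "heis \<Rightarrow> heis" where "T (x, y, z) = (0, 0, 1)"

fun contact_form :: "heis \<Rightarrow> heis \<Rightarrow> real" where
  "contact_form (x, y, z) (v1, v2, v3) = v3 + x * v2 - y * v1"

definition contact_plane :: "heis \<Rightarrow> heis set" where
  "contact_plane p = {v. contact_form p v = 0}"

text \<open>The coefficients of \<open>v\<close> in the frame \<open>E1, E2, T\<close> are \<open>dx(v), dy(v), \<Theta>(v)\<close>.\<close>

fun heis_inner :: "heis \<Rightarrow> heis \<Rightarrow> heis \<Rightarrow> real" where
  "heis_inner p (v1, v2, v3) (w1, w2, w3) =
     v1 * w1 + v2 * w2 + contact_form p (v1, v2, v3) * contact_form p (w1, w2, w3)"

text \<open>\<open>J\<close> is an endomorphism of the contact plane; the formula below extends it by \<open>J T = 0\<close>,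
  but it is only ever applied to contact vectors.\<close>

definition J :: "heis \<Rightarrow> heis \<Rightarrow> heis" where
  "J p v = heis_inner p v (E1 p) *\<^sub>R E2 p - heis_inner p v (E2 p) *\<^sub>R E1 p"

lemma left_invariant_frame:
  "(heis_mult p has_derivative
      (\<lambda>v. (fst v, fst (snd v), snd (snd v) + fst (snd p) * fst v - fst p * fst (snd v)))) (at q)"
  "frechet_derivative (heis_mult p) (at q) (E1 q) = E1 (heis_mult p q)"
  "frechet_derivative (heis_mult p) (at q) (E2 q) = E2 (heis_mult p q)"
  "frechet_derivative (heis_mult p) (at q) (T q) = T (heis_mult p q)"
proof -
  have eq: "heis_mult p = (\<lambda>q. (fst p + fst q, fst (snd p) + fst (snd q),
      snd (snd p) + snd (snd q) + fst (snd p) * fst q - fst p * fst (snd q)))"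
    by (rule ext) (metis heis_mult.simps prod.collapse)
  show D: "(heis_mult p has_derivative
      (\<lambda>v. (fst v, fst (snd v), snd (snd v) + fst (snd p) * fst v - fst p * fst (snd v)))) (at q)"
    unfolding eq by (auto intro!: derivative_eq_intros)
  note D' = frechet_derivative_at[OF D, symmetric]
  show "frechet_derivative (heis_mult p) (at q) (E1 q) = E1 (heis_mult p q)"
    "frechet_derivative (heis_mult p) (at q) (E2 q) = E2 (heis_mult p q)"
    "frechet_derivative (heis_mult p) (at q) (T q) = T (heis_mult p q)"
    unfolding D' by (cases p; cases q; simp)+
qed

lemma frame_orthonormal:
  "heis_inner p (E1 p) (E1 p) = 1" "heis_inner p (E2 p) (E2 p) = 1" "heis_inner p (T p) (T p) = 1"
  "heis_inner p (E1 p) (E2 p) = 0" "heis_inner p (E1 p) (T p) = 0" "heis_inner p (E2 p) (T p) = 0"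
  by (cases p; simp)+

lemma J_frame: "J p (E1 p) = E2 p" "J p (E2 p) = - E1 p"
  by (cases p; simp add: J_def)+

section \<open>Parametrized surfaces\<close>

definition tangent_plane :: "(real \<times> real \<Rightarrow> heis) \<Rightarrow> real \<times> real \<Rightarrow> heis set" where
  "tangent_plane F p = range (frechet_derivative F (at p))"

definition immersion_at :: "(real \<times> real \<Rightarrow> heis) \<Rightarrow> real \<times> real \<Rightarrow> bool" where
  "immersion_at F p \<longleftrightarrow> F differentiable (at p) \<and> inj (frechet_derivative F (at p))"

definition singular_at :: "(real \<times> real \<Rightarrow> heis) \<Rightarrow> real \<times> real \<Rightarrow> bool" where
  "singular_at F p \<longleftrightarrow> tangent_plane F p = contact_plane (F p)"

definition regular_part :: "(real \<times> real \<Rightarrow> heis) \<Rightarrow> (real \<times> real) set" where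
  "regular_part F = {p. immersion_at F p \<and> \<not> singular_at F p}"

definition regular_surface :: "(real \<times> real \<Rightarrow> heis) \<Rightarrow> (real \<times> real) set \<Rightarrow> bool" where
  "regular_surface F U \<longleftrightarrow> open U \<and> U \<noteq> {} \<and> smooth_on U F \<and> U \<subseteq> regular_part F"

definition pd1 :: "(real \<times> real \<Rightarrow> heis) \<Rightarrow> real \<times> real \<Rightarrow> heis" where
  "pd1 F p = frechet_derivative F (at p) (1, 0)"

definition pd2 :: "(real \<times> real \<Rightarrow> heis) \<Rightarrow> real \<times> real \<Rightarrow> heis" where
  "pd2 F p = frechet_derivative F (at p) (0, 1)"

text \<open>Since surfaces are only immersed, vector fields on a surface are fields along the
  parametrization \<open>F\<close>: \<open>W p\<close> is a tangent vector of the Heisenberg group at \<open>F p\<close>.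
  \<open>nabla F W p u\<close> is the covariant derivative of such a field in the direction \<open>dF\<^sub>p(u)\<close>,
  for the connection making \<open>E1, E2, T\<close> parallel.\<close>

definition nabla ::
  "(real \<times> real \<Rightarrow> heis) \<Rightarrow> (real \<times> real \<Rightarrow> heis) \<Rightarrow> real \<times> real \<Rightarrow> real \<times> real \<Rightarrow> heis" where
  "nabla F W p u =
     frechet_derivative (\<lambda>q. heis_inner (F q) (W q) (E1 (F q))) (at p) u *\<^sub>R E1 (F p)
   + frechet_derivative (\<lambda>q. heis_inner (F q) (W q) (E2 (F q))) (at p) u *\<^sub>R E2 (F p)
   + frechet_derivative (\<lambda>q. heis_inner (F q) (W q) (T (F q))) (at p) u *\<^sub>R T (F p)"

text \<open>The unit field \<open>e1\<close> is determined only up to sign, so it is a parameter of all that follows.\<close>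

definition characteristic_field ::
  "(real \<times> real \<Rightarrow> heis) \<Rightarrow> (real \<times> real) set \<Rightarrow> (real \<times> real \<Rightarrow> heis) \<Rightarrow> bool" where
  "characteristic_field F U e1 \<longleftrightarrow> smooth_on U e1 \<and>
     (\<forall>p\<in>U. e1 p \<in> tangent_plane F p \<inter> contact_plane (F p) \<and> heis_inner (F p) (e1 p) (e1 p) = 1)"

definition e2_of :: "(real \<times> real \<Rightarrow> heis) \<Rightarrow> (real \<times> real \<Rightarrow> heis) \<Rightarrow> real \<times> real \<Rightarrow> heis" where
  "e2_of F e1 p = J (F p) (e1 p)"

definition p_mean_curvature ::
  "(real \<times> real \<Rightarrow> heis) \<Rightarrow> (real \<times> real \<Rightarrow> heis) \<Rightarrow> real \<times> real \<Rightarrow> real" where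
  "p_mean_curvature F e1 p =
     (THE h. \<exists>u. frechet_derivative F (at p) u = e1 p \<and> nabla F (e2_of F e1) p u = - (h *\<^sub>R e1 p))"

definition p_minimal ::
  "(real \<times> real \<Rightarrow> heis) \<Rightarrow> (real \<times> real) set \<Rightarrow> (real \<times> real \<Rightarrow> heis) \<Rightarrow> bool" where
  "p_minimal F U e1 \<longleftrightarrow> (\<forall>p\<in>U. p_mean_curvature F e1 p = 0)"

definition alpha ::
  "(real \<times> real \<Rightarrow> heis) \<Rightarrow> (real \<times> real \<Rightarrow> heis) \<Rightarrow> real \<times> real \<Rightarrow> real" where
  "alpha F e1 p = (THE a. a *\<^sub>R e2_of F e1 p + T (F p) \<in> tangent_plane F p)"

definition e2_hat ::
  "(real \<times> real \<Rightarrow> heis) \<Rightarrow> (real \<times> real \<Rightarrow> heis) \<Rightarrow> real \<times> real \<Rightarrow> heis" where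
  "e2_hat F e1 p =
     (1 / sqrt (1 + (alpha F e1 p)\<^sup>2)) *\<^sub>R (alpha F e1 p *\<^sub>R e2_of F e1 p + T (F p))"

section \<open>Special type I\<close>

definition coordinates_on :: "(real \<times> real) set \<Rightarrow> (real \<times> real \<Rightarrow> real \<times> real) \<Rightarrow> bool" where
  "coordinates_on U \<phi> \<longleftrightarrow> open U \<and> open (\<phi> ` U) \<and> inj_on \<phi> U \<and>
     smooth_on U \<phi> \<and> smooth_on (\<phi> ` U) (inv_into U \<phi>)"

text \<open>\<open>\<phi> p\<close> is the pair of new coordinates of the point with parameter \<open>p\<close>; the
  coordinate fields are the partial derivatives of the reparametrized surface \<open>G\<close>.\<close>

definition normal_coordinates ::
  "(real \<times> real \<Rightarrow> heis) \<Rightarrow> (real \<times> real) set \<Rightarrow> (real \<times> real \<Rightarrow> heis) \<Rightarrow>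
   (real \<Rightarrow> real) \<Rightarrow> (real \<times> real \<Rightarrow> real \<times> real) \<Rightarrow> bool" where
  "normal_coordinates F U e1 \<zeta> \<phi> \<longleftrightarrow>
     coordinates_on U \<phi> \<and> smooth_on (snd ` \<phi> ` U) \<zeta> \<and>
     (\<forall>p\<in>U.
        let G = F \<circ> inv_into U \<phi>;
            a = alpha F e1 p;
            b = a\<^sup>2 / sqrt (1 + a\<^sup>2);
            s = fst (\<phi> p) + \<zeta> (snd (\<phi> p))
        in e1 p = pd1 G (\<phi> p) \<and> e2_hat F e1 p = b *\<^sub>R pd2 G (\<phi> p) \<and> s \<noteq> 0 \<and> a = 1 / s)"

definition special_type_I ::
  "(real \<times> real \<Rightarrow> heis) \<Rightarrow> (real \<times> real) set \<Rightarrow> (real \<times> real \<Rightarrow> heis) \<Rightarrow> bool" where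
  "special_type_I F U e1 \<longleftrightarrow> (\<exists>\<zeta> \<phi>. normal_coordinates F U e1 \<zeta> \<phi>)"

section \<open>The surface attached to a curve\<close>

fun Y_surface :: "(real \<Rightarrow> real) \<Rightarrow> (real \<Rightarrow> real) \<Rightarrow> (real \<Rightarrow> real) \<Rightarrow> real \<times> real \<Rightarrow> heis" where
  "Y_surface x y z (r, \<theta>) =
     (x \<theta> + r * cos \<theta>, y \<theta> + r * sin \<theta>, z \<theta> + r * y \<theta> * cos \<theta> - r * x \<theta> * sin \<theta>)"

definition contact_equation :: "(real \<Rightarrow> real) \<Rightarrow> (real \<Rightarrow> real) \<Rightarrow> (real \<Rightarrow> real) \<Rightarrow> bool" where
  "contact_equation x y z \<longleftrightarrow>
     (\<forall>\<theta>. deriv z \<theta> + x \<theta> * deriv y \<theta> - y \<theta> * deriv x \<theta>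
        - (deriv y \<theta> * cos \<theta> - deriv x \<theta> * sin \<theta>)\<^sup>2 = 0)"

end

theory Submission imports Defs begin

text \<open>Put \<open>A = y' cos \<theta> - x' sin \<theta>\<close>, \<open>B = x' cos \<theta> + y' sin \<theta>\<close> and \<open>s = r + A\<close>. The contact
  equation is exactly what gives \<open>Y\<^sub>\<theta> = B e1 + s e2 + s\<^sup>2 T\<close> with \<open>e1 = Y\<^sub>r\<close>. Hence the
  regular part is \<open>s \<noteq> 0\<close>, \<open>\<alpha> = 1 / s\<close>, and \<open>Y\<^sub>\<theta> - B Y\<^sub>r\<close> is a multiple of
  \<open>\<alpha> e2 + T\<close>. If \<open>\<Gamma>' = B\<close>, this is the coordinate field of \<open>\<theta>\<close> in the coordinates
  \<open>(r + \<Gamma> \<theta>, \<theta>)\<close>, in which \<open>s\<close> is the first coordinate plus \<open>A - \<Gamma>\<close>.\<close>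

section \<open>Differentiability of finite order on open sets\<close>

section \<open>Calculus of smooth maps\<close>

text \<open>On an open set a derivative at a point depends only on values inside the set, so
  agreement on \<open>S\<close> passes to all directional derivatives and the induction continues
  with them.\<close>

lemma Ck_on_cong:
  assumes "open S" "\<And>x. x \<in> S \<Longrightarrow> f x = g x"
  shows "Ck_on k S f \<longleftrightarrow> Ck_on k S g"
  using assms(2)
proof (induction k arbitrary: f g)
  case 0
  then show ?case by (auto intro: continuous_on_cong[THEN iffD1])
next
  case (Suc k)
  have D: "(f has_derivative D) (at x) \<longleftrightarrow> (g has_derivative D) (at x)" if "x \<in> S" for x D
    using has_derivative_transform_within_open[of _ D x UNIV S] assms(1) that Suc.prems by metis
  then have "\<And>x. x \<in> S \<Longrightarrow> frechet_derivative f (at x) = frechet_derivative g (at x)"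
    by (simp add: frechet_derivative_def)
  moreover have "\<And>x. x \<in> S \<Longrightarrow> f differentiable (at x) \<longleftrightarrow> g differentiable (at x)"
    using D by (simp add: differentiable_def)
  ultimately show ?case
    using Suc.IH[of "\<lambda>x. frechet_derivative f (at x) v" "\<lambda>x. frechet_derivative g (at x) v" for v]
    by auto
qed

text \<open>Lets an explicit derivative formula stand in for \<open>frechet_derivative\<close>,
  which the definition mentions. Most closure rules below are inductions on the order through this
  rule.\<close>

lemma Ck_on_SucI:
  assumes "open S" "\<And>x. x \<in> S \<Longrightarrow> (f has_derivative f' x) (at x)" "\<And>v. Ck_on k S (\<lambda>x. f' x v)"
  shows "Ck_on (Suc k) S f"
proof -
  have "frechet_derivative f (at x) = f' x" if "x \<in> S" for x
    using assms(2)[OF that] by (metis frechet_derivative_at)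
  then have "Ck_on k S (\<lambda>x. frechet_derivative f (at x) v)" for v
    using assms(3) Ck_on_cong[OF assms(1), of "\<lambda>x. frechet_derivative f (at x) v" "\<lambda>x. f' x v"]
    by simp
  then show ?thesis
    using assms(2) by (auto simp: differentiable_def)
qed

lemma Ck_on_SucD:
  assumes "Ck_on (Suc k) S f"
  shows "\<And>x. x \<in> S \<Longrightarrow> (f has_derivative frechet_derivative f (at x)) (at x)"
    and "Ck_on k S (\<lambda>x. frechet_derivative f (at x) v)"
  using assms by (auto simp: frechet_derivative_works)

lemma Ck_on_Suc_imp_Ck_on: "Ck_on (Suc k) S f \<Longrightarrow> Ck_on k S f"
proof (induction k arbitrary: f)
  case 0
  then show ?case
    by (auto intro!: continuous_at_imp_continuous_on differentiable_imp_continuous_within)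
next
  case (Suc k)
  then show ?case by (metis Ck_on.simps(2))
qed

lemma Ck_on_subset: "Ck_on k S f \<Longrightarrow> R \<subseteq> S \<Longrightarrow> Ck_on k R f"
  by (induction k arbitrary: f) (auto intro: continuous_on_subset)

lemma Ck_on_const: "open S \<Longrightarrow> Ck_on k S (\<lambda>x. c)"
  by (induction k arbitrary: c)
     (auto intro!: Ck_on_SucI[where f' = "\<lambda>x v. 0"] simp del: Ck_on.simps(2))

lemma Ck_on_add:
  "open S \<Longrightarrow> Ck_on k S f \<Longrightarrow> Ck_on k S g \<Longrightarrow> Ck_on k S (\<lambda>x. f x + g x)"
proof (induction k arbitrary: f g)
  case 0
  then show ?case by (simp add: continuous_on_add)
next
  case (Suc k)
  show ?case
    by (rule Ck_on_SucI[OF Suc.prems(1)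
          has_derivative_add[OF Suc.prems(2,3)[THEN Ck_on_SucD(1)]]
          Suc.IH[OF Suc.prems(1) Suc.prems(2,3)[THEN Ck_on_SucD(2)]]])
qed

lemma Ck_on_linear_compose:
  "bounded_linear L \<Longrightarrow> open S \<Longrightarrow> Ck_on k S f \<Longrightarrow> Ck_on k S (\<lambda>x. L (f x))"
proof (induction k arbitrary: f)
  case 0
  then show ?case by (simp add: bounded_linear.continuous_on)
next
  case (Suc k)
  show ?case
    by (rule Ck_on_SucI[OF Suc.prems(2) bounded_linear.has_derivative[OF Suc.prems(1)
            Ck_on_SucD(1)[OF Suc.prems(3)]] Suc.IH[OF Suc.prems(1,2) Ck_on_SucD(2)[OF Suc.prems(3)]]])
qed

text \<open>By the chain rule the derivative along \<open>v\<close> is \<open>g (L x)\<close>, where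
  \<open>g\<close> is the derivative of \<open>f\<close> along the fixed vector \<open>L v\<close>;
  the shape is preserved, so the induction closes. With \<open>snd\<close> for \<open>L\<close> it
  turns functions of \<theta> into functions of (r, \<theta>).\<close>

lemma Ck_on_compose_linear:
  "bounded_linear L \<Longrightarrow> open S \<Longrightarrow> Ck_on k UNIV f \<Longrightarrow> Ck_on k S (\<lambda>x. f (L x))"
proof (induction k arbitrary: f)
  case 0
  then show ?case
    by (auto intro: continuous_on_compose2[OF _ linear_continuous_on])
next
  case (Suc k)
  show ?case
  proof (rule Ck_on_SucI[OF Suc.prems(2)])
    show "((\<lambda>x. f (L x)) has_derivative (\<lambda>v. frechet_derivative f (at (L x)) (L v))) (at x)" for x
      using has_derivative_compose[OF bounded_linear_imp_has_derivative[OF Suc.prems(1)]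
          Ck_on_SucD(1)[OF Suc.prems(3)]] by auto
    show "Ck_on k S (\<lambda>x. frechet_derivative f (at (L x)) (L v))" for v
      using Suc.IH[OF Suc.prems(1,2) Ck_on_SucD(2)[OF Suc.prems(3)]] .
  qed
qed

lemma Ck_on_linear: "bounded_linear L \<Longrightarrow> open S \<Longrightarrow> Ck_on k S L"
  by (cases k)
     (auto intro!: Ck_on_SucI[where f' = "\<lambda>x. L"] Ck_on_const bounded_linear_imp_has_derivative
        linear_continuous_on simp del: Ck_on.simps(2))

lemma Ck_on_mult:
  fixes f g :: "'a::real_normed_vector \<Rightarrow> real"
  shows "open S \<Longrightarrow> Ck_on k S f \<Longrightarrow> Ck_on k S g \<Longrightarrow> Ck_on k S (\<lambda>x. f x * g x)"
proof (induction k arbitrary: f g)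
  case 0
  then show ?case by (simp add: continuous_on_mult)
next
  case (Suc k)
  show ?case
    \<comment> \<open>The summands of the product rule also contain \<open>f\<close> and
      \<open>g\<close> undifferentiated; these are weakened from order \<open>Suc k\<close> to
      \<open>k\<close> before the induction hypothesis applies.\<close>
    by (rule Ck_on_SucI[OF Suc.prems(1) has_derivative_mult])
       (use Suc.prems in \<open>auto intro!: Ck_on_add Suc.IH intro: Ck_on_SucD Ck_on_Suc_imp_Ck_on
          simp del: Ck_on.simps\<close>)
qed

section \<open>Smoothness of all orders, antiderivatives and trigonometric functions\<close>

lemma smooth_on_Suc_k: "smooth_on S f \<Longrightarrow> Ck_on (Suc k) S f"
  unfolding smooth_on_def by blast

lemma smooth_on_cong:
  "open S \<Longrightarrow> (\<And>x. x \<in> S \<Longrightarrow> f x = g x) \<Longrightarrow> smooth_on S f \<longleftrightarrow> smooth_on S g"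
  unfolding smooth_on_def using Ck_on_cong by blast

lemma smooth_on_subset: "smooth_on S f \<Longrightarrow> R \<subseteq> S \<Longrightarrow> smooth_on R f"
  unfolding smooth_on_def using Ck_on_subset by blast

lemma smooth_on_frechet_derivative:
  "smooth_on S f \<Longrightarrow> smooth_on S (\<lambda>x. frechet_derivative f (at x) v)"
  unfolding smooth_on_def using Ck_on_SucD(2) by blast

lemma smooth_on_imp_has_derivative:
  "smooth_on S f \<Longrightarrow> x \<in> S \<Longrightarrow> (f has_derivative frechet_derivative f (at x)) (at x)"
  using Ck_on_SucD(1) smooth_on_Suc_k by blast

lemma smooth_on_imp_continuous_on: "smooth_on S f \<Longrightarrow> continuous_on S f"
  unfolding smooth_on_def by (metis Ck_on.simps(1))

lemma smooth_on_imp_DERIV: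
  fixes f :: "real \<Rightarrow> real"
  assumes "smooth_on UNIV f"
  shows "(f has_real_derivative deriv f t) (at t)"
  using smooth_on_imp_has_derivative[OF assms UNIV_I, of t] DERIV_deriv_iff_real_differentiable
  by (auto simp: differentiable_def)

lemma smooth_on_linear_compose:
  "bounded_linear L \<Longrightarrow> open S \<Longrightarrow> smooth_on S f \<Longrightarrow> smooth_on S (\<lambda>x. L (f x))"
  unfolding smooth_on_def using Ck_on_linear_compose by blast

lemma smooth_on_compose_snd:
  "smooth_on UNIV f \<Longrightarrow> smooth_on UNIV (\<lambda>x. f (snd x))"
  unfolding smooth_on_def using Ck_on_compose_linear[OF bounded_linear_snd open_UNIV] by blast

lemma smooth_on_fst: "smooth_on UNIV fst"
  unfolding smooth_on_def using Ck_on_linear[OF bounded_linear_fst open_UNIV] by blast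

lemma smooth_on_snd: "smooth_on UNIV snd"
  unfolding smooth_on_def using Ck_on_linear[OF bounded_linear_snd open_UNIV] by blast

lemma smooth_on_add:
  "open S \<Longrightarrow> smooth_on S f \<Longrightarrow> smooth_on S g \<Longrightarrow> smooth_on S (\<lambda>x. f x + g x)"
  unfolding smooth_on_def using Ck_on_add by blast

lemma smooth_on_mult:
  fixes f g :: "'a::real_normed_vector \<Rightarrow> real"
  shows "open S \<Longrightarrow> smooth_on S f \<Longrightarrow> smooth_on S g \<Longrightarrow> smooth_on S (\<lambda>x. f x * g x)"
  unfolding smooth_on_def using Ck_on_mult by blast

lemma smooth_on_diff:
  assumes "open S" "smooth_on S f" "smooth_on S g"
  shows "smooth_on S (\<lambda>x. f x - g x)"
  using smooth_on_add[OF assms(1,2) smooth_on_linear_compose[OF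
        bounded_linear_minus[OF bounded_linear_ident] assms(1,3)]]
  by simp

lemma smooth_on_Pair:
  assumes "open S" "smooth_on S f" "smooth_on S g"
  shows "smooth_on S (\<lambda>x. (f x, g x))"
proof -
  \<comment> \<open>A pair is the sum of the images of its entries under two linear embeddings, so
    sums and linear maps suffice.\<close>
  have "bounded_linear (\<lambda>a::'b. (a, 0::'c))" "bounded_linear (\<lambda>b::'c. (0::'b, b))"
    by (intro bounded_linear_Pair bounded_linear_ident bounded_linear_zero)+
  note this[THEN smooth_on_linear_compose, OF assms(1)]
  from smooth_on_add[OF assms(1) this(1)[OF assms(2)] this(2)[OF assms(3)]] show ?thesis
    by simp
qed

lemma smooth_on_antiderivative:
  assumes "antiderivative F f" "smooth_on UNIV f"
  shows "smooth_on UNIV F"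
proof -
  have D: "(F has_derivative (\<lambda>v. f t * v)) (at t)" for t
    using assms(1) by (simp add: antiderivative_def has_field_derivative_def)
  have "Ck_on (Suc k) UNIV F" for k
    by (rule Ck_on_SucI[OF _ D])
       (use assms(2) in \<open>auto simp: smooth_on_def intro!: Ck_on_mult Ck_on_const\<close>)
  then show ?thesis
    unfolding smooth_on_def using Ck_on_Suc_imp_Ck_on by blast
qed

lemma smooth_on_deriv:
  fixes f :: "real \<Rightarrow> real"
  assumes "smooth_on UNIV f"
  shows "smooth_on UNIV (deriv f)"
proof -
  have "deriv f t = frechet_derivative f (at t) 1" for t
    using frechet_derivative_at[OF smooth_on_imp_DERIV[OF assms, of t, unfolded has_field_derivative_def]]
    by (metis mult.right_neutral)
  then have "deriv f = (\<lambda>t. frechet_derivative f (at t) 1)"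
    by blast
  then show ?thesis
    using smooth_on_frechet_derivative[OF assms] by simp
qed

lemma smooth_on_cos_sin: "smooth_on UNIV (cos :: real \<Rightarrow> real)" "smooth_on UNIV (sin :: real \<Rightarrow> real)"
proof -
  have C: "((cos :: real \<Rightarrow> real) has_derivative (\<lambda>v. - v * sin t)) (at t)" for t
    by (auto intro!: derivative_eq_intros)
  have S: "((sin :: real \<Rightarrow> real) has_derivative (\<lambda>v. v * cos t)) (at t)" for t
    by (auto intro!: derivative_eq_intros)
  \<comment> \<open>Up to sign each function is the derivative of the other, hence one joint
    induction.\<close>
  have "Ck_on k UNIV (cos :: real \<Rightarrow> real) \<and> Ck_on k UNIV (sin :: real \<Rightarrow> real)" for k
  proof (induction k)
    case 0
    show ?case by (auto intro!: continuous_intros)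
  next
    case (Suc k)
    then show ?case
      by (auto intro!: Ck_on_SucI[OF open_UNIV C] Ck_on_SucI[OF open_UNIV S] Ck_on_mult Ck_on_const
          simp del: Ck_on.simps)
  qed
  then show "smooth_on UNIV (cos :: real \<Rightarrow> real)" "smooth_on UNIV (sin :: real \<Rightarrow> real)"
    by (auto simp: smooth_on_def)
qed

text \<open>The fundamental theorem of calculus on the whole line; it supplies the \<Gamma> that
  special type I asks for.\<close>

lemma ex_antiderivative:
  assumes "continuous_on UNIV f"
  shows "\<exists>F. antiderivative F f"
  using einterval_antiderivative[of "-\<infinity>" "\<infinity>" f] assms
  by (auto simp: antiderivative_def continuous_on_eq_continuous_at
      has_real_derivative_iff_has_vector_derivative)

section \<open>The ruled surface\<close>

locale heis_curve =
  fixes x y z :: "real \<Rightarrow> real"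
  assumes smooth: "smooth_on UNIV x" "smooth_on UNIV y" "smooth_on UNIV z"
begin

text \<open>\<open>A\<close> and \<open>B\<close> are the components of the planar velocity (x', y')
  across and along the ruling direction (cos \<theta>, sin \<theta>).\<close>

definition A :: "real \<Rightarrow> real" where
  "A \<theta> = deriv y \<theta> * cos \<theta> - deriv x \<theta> * sin \<theta>"

definition B :: "real \<Rightarrow> real" where
  "B \<theta> = deriv x \<theta> * cos \<theta> + deriv y \<theta> * sin \<theta>"

abbreviation Y where "Y \<equiv> Y_surface x y z"

definition s :: "real \<times> real \<Rightarrow> real" where
  "s p = fst p + A (snd p)"

text \<open>\<open>f1\<close> and \<open>f2\<close> are \<open>E1\<close> and \<open>E2\<close>
  rotated by \<theta>. They turn out to be e1 and e2 (\<open>pd1_Y\<close>, \<open>e2_of_Y\<close>),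
  but are given without derivatives so that frame algebra precedes the calculus.\<close>

definition f1 :: "real \<times> real \<Rightarrow> heis" where
  "f1 p = cos (snd p) *\<^sub>R E1 (Y p) + sin (snd p) *\<^sub>R E2 (Y p)"

definition f2 :: "real \<times> real \<Rightarrow> heis" where
  "f2 p = cos (snd p) *\<^sub>R E2 (Y p) - sin (snd p) *\<^sub>R E1 (Y p)"

text \<open>Coefficients in the frame \<open>f1\<close>, \<open>f2\<close>, \<open>T\<close>:
  questions about tangent vectors become comparisons of three real numbers through
  \<open>comb_eq_iff\<close>.\<close>

definition comb :: "real \<times> real \<Rightarrow> real \<Rightarrow> real \<Rightarrow> real \<Rightarrow> heis" where
  "comb p a b c = a *\<^sub>R f1 p + b *\<^sub>R f2 p + c *\<^sub>R T (Y p)"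

lemmas derivs = smooth[THEN smooth_on_imp_DERIV]

lemma smooth_AB: "smooth_on UNIV A" "smooth_on UNIV B"
  unfolding A_def[abs_def] B_def[abs_def]
  by (intro smooth_on_add smooth_on_diff smooth_on_mult smooth_on_deriv smooth smooth_on_cos_sin open_UNIV)+

lemma Y_eq: "Y = (\<lambda>p. (x (snd p) + fst p * cos (snd p), y (snd p) + fst p * sin (snd p),
   z (snd p) + fst p * y (snd p) * cos (snd p) - fst p * x (snd p) * sin (snd p)))"
  by (auto simp: fun_eq_iff)

lemma smooth_Y: "smooth_on UNIV Y"
  unfolding Y_eq
  by (intro smooth_on_Pair smooth_on_add smooth_on_diff smooth_on_mult smooth_on_fst
      smooth_on_compose_snd smooth smooth_on_cos_sin open_UNIV)

lemma velocity: "deriv x t = B t * cos t - A t * sin t" "deriv y t = B t * sin t + A t * cos t"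
  using sin_cos_squared_add[of t] unfolding A_def B_def by algebra+

lemma comb_eq:
  "comb p a b c = (let (X1, X2, X3) = Y p; u = a * cos (snd p) - b * sin (snd p);
     v = a * sin (snd p) + b * cos (snd p) in (u, v, c + u * X2 - v * X1))"
  by (cases "Y p") (simp add: comb_def f1_def f2_def algebra_simps)

lemma contact_form_comb: "contact_form (Y p) (comb p a b c) = c"
  by (cases "Y p") (simp add: comb_eq algebra_simps)

lemma heis_inner_comb:
  "heis_inner (Y p) (comb p a b c) (E1 (Y p)) = a * cos (snd p) - b * sin (snd p)"
  "heis_inner (Y p) (comb p a b c) (E2 (Y p)) = a * sin (snd p) + b * cos (snd p)"
  "heis_inner (Y p) (comb p a b c) (T (Y p)) = c"
  by (cases "Y p"; simp add: comb_eq algebra_simps)+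

text \<open>The contact form recovers \<open>c\<close>, and the products with \<open>E1\<close> and
  \<open>E2\<close> recover (a, b) rotated by \<theta>; a rotation is invertible.\<close>

lemma comb_eq_iff: "comb p a b c = comb p a' b' c' \<longleftrightarrow> a = a' \<and> b = b' \<and> c = c'"
proof
  assume eq: "comb p a b c = comb p a' b' c'"
  have "c = c'"
    using contact_form_comb[of p a b c] contact_form_comb[of p a' b' c'] eq by simp
  moreover have "a * cos (snd p) - b * sin (snd p) = a' * cos (snd p) - b' * sin (snd p)"
    "a * sin (snd p) + b * cos (snd p) = a' * sin (snd p) + b' * cos (snd p)"
    using heis_inner_comb[of p a b c] heis_inner_comb[of p a' b' c'] eq by simp_all
  then have "a = a'" "b = b'"
    using sin_cos_squared_add[of "snd p"] by algebra+
  ultimately show "a = a' \<and> b = b' \<and> c = c'" by simp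
qed simp

lemma comb_0: "comb p 0 0 0 = 0" by (simp add: comb_def)

lemma J_f1: "J (Y p) (comb p 1 0 0) = comb p 0 1 0"
  unfolding J_def heis_inner_comb by (simp add: comb_def f2_def)

end

section \<open>The differential of Y and its regular part\<close>

locale contact_heis_curve = heis_curve +
  assumes contact: "contact_equation x y z"
begin

text \<open>The form in which the contact equation enters the computation of dY.\<close>

lemma deriv_z: "deriv z t = (A t)\<^sup>2 + y t * deriv x t - x t * deriv y t"
  using contact unfolding contact_equation_def A_def by (smt (verit))

text \<open>The contact form of Y_\<theta> is A^2 + 2 r A + r^2 = s^2: the contact equation supplies
  A^2, the ruling the other two terms. The planar part of Y_\<theta> is the velocity plus r times
  the unit normal of the ruling, which raises the coefficient A of \<open>f2\<close> to s.\<close>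

lemma has_derivative_Y:
  "(Y has_derivative
     (\<lambda>u. comb p (fst u + snd u * B (snd p)) (snd u * s p) (snd u * (s p)\<^sup>2))) (at p)"
proof -
  obtain r t where p: "p = (r, t)" by (cases p)
  note D [derivative_intros] = derivs[unfolded has_field_derivative_def,
      THEN has_derivative_compose[OF has_derivative_snd[OF has_derivative_ident]]]
  have "(Y has_derivative (\<lambda>u. (deriv x t * snd u + fst u * cos t - r * sin t * snd u,
       deriv y t * snd u + fst u * sin t + r * cos t * snd u,
       deriv z t * snd u + fst u * y t * cos t + r * (deriv y t * snd u) * cos t - r * y t * sin t * snd u
        - fst u * x t * sin t - r * (deriv x t * snd u) * sin t - r * x t * cos t * snd u))) (at p)"
    unfolding Y_eq p
    by (auto intro!: derivative_eq_intros simp: algebra_simps)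
  moreover have "(deriv x t * v + u * cos t - r * sin t * v,
       deriv y t * v + u * sin t + r * cos t * v,
       deriv z t * v + u * y t * cos t + r * (deriv y t * v) * cos t - r * y t * sin t * v
        - u * x t * sin t - r * (deriv x t * v) * sin t - r * x t * cos t * v)
      = comb p (u + v * B (snd p)) (v * s p) (v * (s p)\<^sup>2)" for u v
  proof -
    \<comment> \<open>Rewrites that eliminate squared cosines, once for a bare product and once for
      a product with a further factor.\<close>
    have cos2: "cos t * cos t = 1 - sin t * sin t" "cos t * (cos t * w) = w - sin t * (sin t * w)" for w
      using sin_cos_squared_add3[of t] by algebra+
    show ?thesis
      unfolding deriv_z unfolding velocity p comb_eq s_def
      by (simp add: Let_def algebra_simps power2_eq_square cos2)
  qed
  ultimately show ?thesis by (simp only:)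
qed

lemma frechet_Y:
  "frechet_derivative Y (at p) u =
     comb p (fst u + snd u * B (snd p)) (snd u * s p) (snd u * (s p)\<^sup>2)"
  by (simp only: frechet_derivative_at[OF has_derivative_Y, symmetric])

lemma pd1_Y: "pd1 Y p = comb p 1 0 0"
  by (simp add: pd1_def frechet_Y)

lemma e2_of_Y: "e2_of Y (pd1 Y) p = comb p 0 1 0"
  by (simp add: e2_of_def pd1_Y J_f1)

text \<open>The image of dY is spanned by \<open>f1\<close> and s (f2 + s T). Where s = 0 it shrinks
  to the line of \<open>f1\<close>, which is the case the second conjunct covers.\<close>

lemma comb_in_tangent_plane_iff: "comb p a b c \<in> tangent_plane Y p \<longleftrightarrow> c = b * s p \<and> (s p = 0 \<longrightarrow> b = 0)"
proof
  assume "comb p a b c \<in> tangent_plane Y p"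
  then show "c = b * s p \<and> (s p = 0 \<longrightarrow> b = 0)"
    by (auto simp: tangent_plane_def frechet_Y comb_eq_iff power2_eq_square)
next
  assume c: "c = b * s p \<and> (s p = 0 \<longrightarrow> b = 0)"
  \<comment> \<open>The second entry solves \<open>b = v * s p\<close> for \<open>v\<close>, the
    first compensates for the B term. If \<open>s p = 0\<close>, then \<open>b = 0\<close>, and
    \<open>b / s p\<close> is 0 as required.\<close>
  then have "comb p a b c = frechet_derivative Y (at p) (a - b / s p * B (snd p), b / s p)"
    by (auto simp: frechet_Y comb_eq_iff power2_eq_square)
  then show "comb p a b c \<in> tangent_plane Y p"
    unfolding tangent_plane_def by blast
qed

text \<open>For s \<noteq> 0 the tangent vector f2 + s T has contact form s and so leaves the
  contact plane. For s = 0 the vector (-B, 1) lies in the kernel of dY, so Y is no immersion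
  there.\<close>

lemma regular_part_Y: "regular_part Y = {p. s p \<noteq> 0}"
proof -
  have "p \<in> regular_part Y" if "s p \<noteq> 0" for p
  proof -
    have "immersion_at Y p"
      unfolding immersion_at_def
      using that has_derivative_Y[of p]
      by (auto simp: inj_def frechet_Y comb_eq_iff differentiable_def)
    moreover have "comb p 0 1 (s p) \<in> tangent_plane Y p" "comb p 0 1 (s p) \<notin> contact_plane (Y p)"
      using that by (auto simp: comb_in_tangent_plane_iff contact_plane_def contact_form_comb)
    ultimately show ?thesis
      by (auto simp: regular_part_def singular_at_def)
  qed
  moreover have "p \<notin> regular_part Y" if "s p = 0" for p
  proof -
    have "frechet_derivative Y (at p) (- B (snd p), 1) = frechet_derivative Y (at p) (0, 0)"
      using that by (simp add: frechet_Y)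
    then have "\<not> inj (frechet_derivative Y (at p))"
      by (auto dest: injD)
    then show ?thesis by (simp add: regular_part_def immersion_at_def)
  qed
  ultimately show ?thesis by blast
qed

lemma smooth_s: "smooth_on UNIV s"
  unfolding s_def[abs_def]
  by (intro smooth_on_add smooth_on_fst smooth_on_compose_snd smooth_AB open_UNIV)

lemma open_regular_part_Y: "open (regular_part Y)"
  unfolding regular_part_Y
  by (intro open_Collect_neq smooth_on_imp_continuous_on smooth_s continuous_on_const)

lemma regular_surface_Y: "regular_surface Y (regular_part Y)"
proof -
  \<comment> \<open>A point with s = 1 shows that the regular part is nonempty.\<close>
  have "(1 - A 0, 0) \<in> regular_part Y" by (simp add: regular_part_Y s_def)
  then show ?thesis
    unfolding regular_surface_def
    using open_regular_part_Y smooth_on_subset[OF smooth_Y] by auto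
qed

section \<open>Characteristic field, p-minimality, \<alpha> and normal coordinates\<close>

lemma characteristic_field_Y: "characteristic_field Y (regular_part Y) (pd1 Y)"
proof -
  have "smooth_on UNIV (pd1 Y)"
    unfolding pd1_def[abs_def] by (rule smooth_on_frechet_derivative[OF smooth_Y])
  moreover have "heis_inner (Y p) (comb p 1 0 0) (comb p 1 0 0) = 1" for p
    by (cases "Y p") (simp add: comb_eq Let_def power2_eq_square[symmetric])
  ultimately show ?thesis
    unfolding characteristic_field_def
    by (auto simp: pd1_Y comb_in_tangent_plane_iff contact_plane_def contact_form_comb
        intro: smooth_on_subset)
qed

text \<open>The field \<open>e2\<close> has coefficients \<open>- sin \<theta>, cos \<theta>, 0\<close> in the parallel frame, and
  these are constant along the rulings.\<close>

lemma p_minimal_Y: "p_minimal Y (regular_part Y) (pd1 Y)"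
  unfolding p_minimal_def
proof
  fix p assume p: "p \<in> regular_part Y"
  have coeffs: "(\<lambda>q. heis_inner (Y q) (e2_of Y (pd1 Y) q) (E1 (Y q))) = (\<lambda>q. - sin (snd q))"
    "(\<lambda>q. heis_inner (Y q) (e2_of Y (pd1 Y) q) (E2 (Y q))) = (\<lambda>q. cos (snd q))"
    "(\<lambda>q. heis_inner (Y q) (e2_of Y (pd1 Y) q) (T (Y q))) = (\<lambda>q. 0)"
    by (simp_all add: e2_of_Y heis_inner_comb)
  have d: "((\<lambda>q::real\<times>real. - sin (snd q)) has_derivative (\<lambda>u. - (snd u * cos (snd p)))) (at p)"
    "((\<lambda>q::real\<times>real. cos (snd q)) has_derivative (\<lambda>u. - (snd u * sin (snd p)))) (at p)"
    by (auto intro!: derivative_eq_intros)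
  have nabla: "nabla Y (e2_of Y (pd1 Y)) p (1, 0) = 0"
    unfolding nabla_def coeffs d[THEN frechet_derivative_at, symmetric] frechet_derivative_const
    by (simp add: zero_prod_def)
  \<comment> \<open>Since s \<noteq> 0, e1 comes from exactly one parameter direction, so the
    existential in the curvature has the single witness (1, 0).\<close>
  have u: "frechet_derivative Y (at p) u = pd1 Y p \<longleftrightarrow> u = (1, 0)" for u
    using p by (cases u) (auto simp: frechet_Y pd1_Y comb_eq_iff regular_part_Y)
  \<comment> \<open>Makes \<open>h\<close> unique: a vanishing multiple of e1 has coefficient
    0.\<close>
  have "pd1 Y p \<noteq> 0"
    using comb_eq_iff[of p 1 0 0 0 0 0] by (simp add: pd1_Y comb_0)
  then show "p_mean_curvature Y (pd1 Y) p = 0"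
    unfolding p_mean_curvature_def by (simp add: u nabla)
qed

text \<open>By the tangency criterion, \<open>a\<close> times e2 plus \<open>T\<close> is tangent
  precisely when \<open>a * s p = 1\<close>.\<close>

lemma alpha_Y:
  assumes "p \<in> regular_part Y"
  shows "alpha Y (pd1 Y) p = 1 / s p"
proof -
  have "a *\<^sub>R e2_of Y (pd1 Y) p + T (Y p) = comb p 0 a 1" for a
    by (simp add: e2_of_Y) (simp add: comb_def)
  then show ?thesis
    unfolding alpha_def using assms
    by (intro the_equality) (auto simp: comb_in_tangent_plane_iff regular_part_Y field_simps)
qed

text \<open>The shear keeps the coordinate field Y_r, and its inverse subtracts the B component from
  Y_\<theta>, leaving s e2 + s^2 T.\<close>

lemma normal_coordinates_Y:
  assumes \<Gamma>: "antiderivative \<Gamma> B"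
  shows "normal_coordinates Y (regular_part Y) (pd1 Y) (\<lambda>\<theta>. A \<theta> - \<Gamma> \<theta>)
    (\<lambda>p. (fst p + \<Gamma> (snd p), snd p))"
proof -
  define U where "U = regular_part Y"
  define \<phi> where "\<phi> = (\<lambda>p. (fst p + \<Gamma> (snd p), snd p))"
  \<comment> \<open>The global inverse of the shear. \<open>inv_into U \<phi>\<close> is controlled
    only on the image of \<open>U\<close>, so calculus is done with \<psi> and then
    transferred.\<close>
  define \<psi> where "\<psi> = (\<lambda>p. (fst p - \<Gamma> (snd p), snd p))"
  have inverse: "\<psi> (\<phi> p) = p" "\<phi> (\<psi> p) = p" for p
    by (simp_all add: \<phi>_def \<psi>_def)
  have inj: "inj_on \<phi> U"
    using inverse(1) by (rule inj_on_inverseI)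
  \<comment> \<open>As a preimage under the continuous \<psi>, the image of \<open>U\<close> is
    open.\<close>
  have image: "\<phi> ` U = \<psi> -` U"
  proof
    show "\<phi> ` U \<subseteq> \<psi> -` U"
      using inverse(1) by (simp add: image_subset_iff)
    show "\<psi> -` U \<subseteq> \<phi> ` U"
      using inverse(2) by (metis image_eqI subsetI vimageD)
  qed
  have inv_into: "inv_into U \<phi> q = \<psi> q" if "q \<in> \<phi> ` U" for q
    using that inverse inj by (auto simp: inv_into_f_f)
  have smooth_\<Gamma>: "smooth_on UNIV \<Gamma>"
    by (rule smooth_on_antiderivative[OF \<Gamma> smooth_AB(2)])
  have smooth_\<phi>: "smooth_on UNIV \<phi>" and smooth_\<psi>: "smooth_on UNIV \<psi>"
    unfolding \<phi>_def \<psi>_def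
    by (intro smooth_on_Pair smooth_on_add smooth_on_diff smooth_on_fst smooth_on_snd
        smooth_on_compose_snd smooth_\<Gamma> open_UNIV)+
  have open_U: "open U" unfolding U_def by (rule open_regular_part_Y)
  then have open_image: "open (\<phi> ` U)"
    unfolding image using smooth_on_imp_continuous_on[OF smooth_\<psi>] by (simp add: open_vimage)
  have "coordinates_on U \<phi>"
    unfolding coordinates_on_def
    using open_U open_image inj smooth_on_subset[OF smooth_\<phi>] smooth_on_subset[OF smooth_\<psi>]
      smooth_on_cong[OF open_image inv_into] by auto
  moreover have "smooth_on (snd ` \<phi> ` U) (\<lambda>\<theta>. A \<theta> - \<Gamma> \<theta>)"
    by (rule smooth_on_subset[of UNIV]) (auto intro: smooth_on_diff smooth_AB smooth_\<Gamma>)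
  moreover have
    "let G = Y \<circ> inv_into U \<phi>; a = alpha Y (pd1 Y) p; b = a\<^sup>2 / sqrt (1 + a\<^sup>2);
       \<sigma> = fst (\<phi> p) + (A (snd (\<phi> p)) - \<Gamma> (snd (\<phi> p)))
     in pd1 Y p = pd1 G (\<phi> p) \<and> e2_hat Y (pd1 Y) p = b *\<^sub>R pd2 G (\<phi> p) \<and> \<sigma> \<noteq> 0 \<and> a = 1 / \<sigma>"
    if p: "p \<in> U" for p
  proof -
    have s: "s p \<noteq> 0" using p by (simp add: U_def regular_part_Y)
    have "(\<Gamma> has_derivative (\<lambda>v. B (snd p) * v)) (at (snd (\<phi> p)))"
      using \<Gamma> by (simp add: antiderivative_def has_field_derivative_def \<phi>_def)
    note has_derivative_compose[OF has_derivative_snd[OF has_derivative_ident] this]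
    then have "(\<psi> has_derivative (\<lambda>u. (fst u - B (snd p) * snd u, snd u))) (at (\<phi> p))"
      unfolding \<psi>_def by (intro derivative_intros)
    \<comment> \<open>The term - B in the derivative of \<psi> cancels the + B in dY.\<close>
    then have "((\<lambda>q. Y (\<psi> q)) has_derivative (\<lambda>u. comb p (fst u) (snd u * s p) (snd u * (s p)\<^sup>2))) (at (\<phi> p))"
      using has_derivative_compose[where f = \<psi>, OF _ has_derivative_Y]
      by (fastforce simp: inverse algebra_simps)
    then have "(Y \<circ> inv_into U \<phi> has_derivative
        (\<lambda>u. comb p (fst u) (snd u * s p) (snd u * (s p)\<^sup>2))) (at (\<phi> p))"
      by (rule has_derivative_transform_within_open[OF _ open_image]) (use p inv_into in auto)
    note frechet_derivative_at[OF this, symmetric]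
    then have pd: "pd1 (Y \<circ> inv_into U \<phi>) (\<phi> p) = comb p 1 0 0"
      "pd2 (Y \<circ> inv_into U \<phi>) (\<phi> p) = comb p 0 (s p) ((s p)\<^sup>2)"
      by (simp_all add: pd1_def pd2_def)
    have "fst (\<phi> p) + (A (snd (\<phi> p)) - \<Gamma> (snd (\<phi> p))) = s p"
      by (simp add: \<phi>_def s_def)
    \<comment> \<open>With \<alpha> = 1 / s one has s e2 + s^2 T = s^2 (\<alpha> e2 + T) and b s^2 =
      1 / sqrt (1 + \<alpha>^2), which is the normalizing factor of \<open>e2_hat\<close>.\<close>
    moreover have "e2_hat Y (pd1 Y) p = ((1 / s p)\<^sup>2 / sqrt (1 + (1 / s p)\<^sup>2)) *\<^sub>R comb p 0 (s p) ((s p)\<^sup>2)"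
      using s p unfolding e2_hat_def
      by (simp add: alpha_Y U_def[symmetric] e2_of_Y)
         (simp add: comb_def scaleR_add_right power2_eq_square)
    ultimately show ?thesis
      using s alpha_Y[OF p[unfolded U_def]] by (simp add: Let_def pd pd1_Y)
  qed
  ultimately show ?thesis
    unfolding normal_coordinates_def U_def[symmetric] \<phi>_def[symmetric] by blast
qed

end

section \<open>Integral form of the contact equation and the invariant of the surface\<close>

theorem mainTheorem10:
  fixes x y z :: "real \<Rightarrow> real"
  assumes "smooth_on UNIV x" "smooth_on UNIV y" "smooth_on UNIV z"
  shows "(contact_equation x y z \<longleftrightarrow>
            antiderivative z (\<lambda>\<theta>. (deriv y \<theta> * cos \<theta> - deriv x \<theta> * sin \<theta>)\<^sup>2
                                  + y \<theta> * deriv x \<theta> - x \<theta> * deriv y \<theta>))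
       \<and> (contact_equation x y z \<longrightarrow>
           (let Y = Y_surface x y z; U = regular_part Y; e1 = pd1 Y in
              regular_surface Y U \<and> characteristic_field Y U e1 \<and>
              p_minimal Y U e1 \<and> special_type_I Y U e1 \<and>
              (\<forall>\<Gamma>. antiderivative \<Gamma> (\<lambda>\<theta>. deriv x \<theta> * cos \<theta> + deriv y \<theta> * sin \<theta>) \<longrightarrow>
                 (\<exists>\<phi>. normal_coordinates Y U e1
                        (\<lambda>\<theta>. deriv y \<theta> * cos \<theta> - deriv x \<theta> * sin \<theta> - \<Gamma> \<theta>) \<phi>
                      \<and> (\<forall>p\<in>U. snd (\<phi> p) = snd p)))))"
proof (intro conjI impI)
  interpret heis_curve x y z by unfold_locales fact+
  \<comment> \<open>As \<open>z\<close> is differentiable, being an antiderivative is a pointwise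
    equation for \<open>deriv z\<close>, which is the contact equation rearranged.\<close>
  have "antiderivative z f \<longleftrightarrow> (\<forall>t. deriv z t = f t)" for f
    unfolding antiderivative_def using derivs(3) DERIV_imp_deriv by metis
  then show "contact_equation x y z \<longleftrightarrow>
            antiderivative z (\<lambda>\<theta>. (deriv y \<theta> * cos \<theta> - deriv x \<theta> * sin \<theta>)\<^sup>2
                                  + y \<theta> * deriv x \<theta> - x \<theta> * deriv y \<theta>)"
    unfolding contact_equation_def by (smt (verit))
next
  assume "contact_equation x y z"
  then interpret contact_heis_curve x y z
    using assms by unfold_locales
  obtain \<Gamma> where "antiderivative \<Gamma> B"
    using ex_antiderivative[OF smooth_on_imp_continuous_on[OF smooth_AB(2)]] by blast
  then have "special_type_I Y (regular_part Y) (pd1 Y)"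
    unfolding special_type_I_def using normal_coordinates_Y by blast
  \<comment> \<open>Every antiderivative \<Gamma> yields its own shear. Two of them differ by a
    constant, in accordance with the freedom in the invariant, and each shear fixes
    \<theta>.\<close>
  moreover have "\<exists>\<phi>. normal_coordinates Y (regular_part Y) (pd1 Y)
        (\<lambda>\<theta>. deriv y \<theta> * cos \<theta> - deriv x \<theta> * sin \<theta> - \<Gamma> \<theta>) \<phi> \<and> (\<forall>p\<in>regular_part Y. snd (\<phi> p) = snd p)"
    if "antiderivative \<Gamma> (\<lambda>\<theta>. deriv x \<theta> * cos \<theta> + deriv y \<theta> * sin \<theta>)" for \<Gamma>
    using normal_coordinates_Y[of \<Gamma>] that
    unfolding B_def[abs_def] A_def by (intro exI conjI) auto
  ultimately show "let Y = Y_surface x y z; U = regular_part Y; e1 = pd1 Y in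
              regular_surface Y U \<and> characteristic_field Y U e1 \<and>
              p_minimal Y U e1 \<and> special_type_I Y U e1 \<and>
              (\<forall>\<Gamma>. antiderivative \<Gamma> (\<lambda>\<theta>. deriv x \<theta> * cos \<theta> + deriv y \<theta> * sin \<theta>) \<longrightarrow>
                 (\<exists>\<phi>. normal_coordinates Y U e1
                        (\<lambda>\<theta>. deriv y \<theta> * cos \<theta> - deriv x \<theta> * sin \<theta> - \<Gamma> \<theta>) \<phi>
                      \<and> (\<forall>p\<in>U. snd (\<phi> p) = snd p)))"
    unfolding Let_def
    using regular_surface_Y characteristic_field_Y p_minimal_Y by blast
qed

end
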